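(* Let $G=(V,E)$ be a finite directed acyclic graph. Let $G'=(V',E')$ be the directed graph obtained by subdividing each directed edge of $G$ into three edges in the same direction, i.e., each $(u,v)\in E$ is replaced by the directed edges $(u,x_{uv}),(x_{uv},y_{uv}),(y_{uv},v)$ with new vertices $x_{uv},y_{uv}$. Suppose that there exists an embedding $\phi:V'\to V(H)$ of $G'$ into some directed graph $H$ with bounded distortion. Then $H$ contains $G$ as a minor.
   Context: Distances are shortest directed-path distances, with $d(a,b)=+\infty$ when there is no directed path from $a$ to $b$; edges of $G'$ have unit length and edges of $H$ have positive lengths. An embedding $\phi$ has bounded distortion if there exist constants $0<a\le b<\infty$ such that $a\,d_{G'}(p,q)\le d_H(\phi(p),\phi(q))\le b\,d_{G'}(p,q)$ for all $p,q\in V'$ (in particular $d_H(\phi(p),\phi(q))$ is finite iff $d_{G'}(p,q)$ is finite). $H$ contains $G$ as a minor if a directed graph containing $G$ (with each edge $(u,v)$ of $G$ present as a directed edge) can be obtained from $H$ by deleting vertices and edges and contracting edges. *)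

theory Defs
  imports "Graph_Theory.Graph_Theory"
begin

text \<open>
  Finite simple digraphs, with edge set a set of pairs, are \<open>pair_pre_digraph\<close>s; host
  digraphs are arbitrary \<open>pre_digraph\<close>s (parallel arcs, loops and infinitely many vertices
  are allowed). Distances are \<open>wf_digraph.\<mu>\<close>: the infimum in \<open>ereal\<close> of
  the costs of all directed walks, hence \<open>\<infinity>\<close> if there is none.
\<close>

datatype 'a subdiv_vertex = Orig 'a | SubX 'a 'a | SubY 'a 'a

text \<open>\<open>SubX u v\<close> and \<open>SubY u v\<close> are the new vertices
  \<open>x\<^sub>u\<^sub>v\<close> and \<open>y\<^sub>u\<^sub>v\<close>.\<close>

definition subdivide3 :: "'a pair_pre_digraph \<Rightarrow> 'a subdiv_vertex pair_pre_digraph" where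
  "subdivide3 G = \<lparr>
     pverts = Orig ` pverts G
       \<union> {SubX u v | u v. (u, v) \<in> parcs G}
       \<union> {SubY u v | u v. (u, v) \<in> parcs G},
     parcs = {(Orig u, SubX u v) | u v. (u, v) \<in> parcs G}
       \<union> {(SubX u v, SubY u v) | u v. (u, v) \<in> parcs G}
       \<union> {(SubY u v, Orig v) | u v. (u, v) \<in> parcs G} \<rparr>"

lemma pair_wf_digraph_subdivide3:
  assumes "pair_wf_digraph G"
  shows "pair_wf_digraph (subdivide3 G)"
proof -
  interpret pair_wf_digraph G by (rule assms)
  show ?thesis
    by unfold_locales (auto simp: subdivide3_def dest: wellformed')
qed

definition bounded_distortion ::
  "('a, 'b) pre_digraph \<Rightarrow> ('b \<Rightarrow> real) \<Rightarrow> ('c, 'd) pre_digraph \<Rightarrow> ('d \<Rightarrow> real) \<Rightarrow> ('a \<Rightarrow> 'c) \<Rightarrow> bool"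
where
  "bounded_distortion G w\<^sub>G H w\<^sub>H \<phi> \<longleftrightarrow>
     \<phi> ` verts G \<subseteq> verts H \<and>
     (\<exists>a b :: real. 0 < a \<and> a \<le> b \<and>
       (\<forall>p \<in> verts G. \<forall>q \<in> verts G.
          ereal a * wf_digraph.\<mu> G w\<^sub>G p q \<le> wf_digraph.\<mu> H w\<^sub>H (\<phi> p) (\<phi> q) \<and>
          wf_digraph.\<mu> H w\<^sub>H (\<phi> p) (\<phi> q) \<le> ereal b * wf_digraph.\<mu> G w\<^sub>G p q))"

text \<open>
  Contracting \<open>e\<close> removes \<open>e\<close> and merges its head into its tail; other arcs
  between the two endpoints become loops, and parallel arcs are kept. Contracting a loop
  merely removes it.
\<close>

definition contract_arc :: "('a, 'b) pre_digraph \<Rightarrow> 'b \<Rightarrow> ('a, 'b) pre_digraph" where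
  "contract_arc G e =
     (let f = (\<lambda>v. if v = head G e then tail G e else v)
      in \<lparr> verts = f ` verts G, arcs = arcs G - {e},
           tail = f \<circ> tail G, head = f \<circ> head G \<rparr>)"

lemma wf_digraph_contract_arc:
  assumes "wf_digraph G"
  shows "wf_digraph (contract_arc G e)"
proof -
  interpret wf_digraph G by (rule assms)
  define f where "f = (\<lambda>v. if v = head G e then tail G e else v)"
  have "contract_arc G e = \<lparr> verts = f ` verts G, arcs = arcs G - {e},
      tail = f \<circ> tail G, head = f \<circ> head G \<rparr>"
    unfolding contract_arc_def Let_def f_def ..
  then show ?thesis
    by unfold_locales auto
qed

text \<open>
  Passing to a \<open>subgraph\<close> deletes a set of arcs and a set of vertices together with all
  arcs incident to them. For finite digraphs this amounts to deleting single vertices and arcs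
  repeatedly; in infinite ones a single step may delete infinitely many.
\<close>

inductive reduces_to :: "('a, 'b) pre_digraph \<Rightarrow> ('a, 'b) pre_digraph \<Rightarrow> bool"
  for H where
    refl: "reduces_to H H"
  | delete: "reduces_to H J \<Longrightarrow> subgraph K J \<Longrightarrow> reduces_to H K"
  | contract: "reduces_to H J \<Longrightarrow> e \<in> arcs J \<Longrightarrow> reduces_to H (contract_arc J e)"

definition contains_digraph :: "('c, 'd) pre_digraph \<Rightarrow> ('a, 'b) pre_digraph \<Rightarrow> bool" where
  "contains_digraph J G \<longleftrightarrow> (\<exists>K. subgraph K J \<and> digraph_iso G K)"

definition has_minor :: "('c, 'd) pre_digraph \<Rightarrow> ('a, 'b) pre_digraph \<Rightarrow> bool" where
  "has_minor H G \<longleftrightarrow> (\<exists>J. reduces_to H J \<and> contains_digraph J G)"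

end

theory Submission
  imports Defs "HOL-Library.Disjoint_Sets"
begin

text \<open>
  Bounded distortion matters only through reachability: \<open>\<phi> p\<close> reaches
  \<open>\<phi> q\<close> in \<open>H\<close> iff \<open>p\<close> reaches
  \<open>q\<close> in \<open>G'\<close>. The branch set of a vertex \<open>u\<close> of
  \<open>G\<close> consists of all vertices of \<open>H\<close> lying between
  \<open>\<phi> u\<close> or some \<open>\<phi> y\<^sub>t\<^sub>u\<close> and
  \<open>\<phi> u\<close>, together with those between \<open>\<phi> u\<close> and some
  \<open>\<phi> y\<^sub>u\<^sub>v\<close> that \<open>\<phi> y\<^sub>u\<^sub>v\<close> does not
  reach. A vertex common to the branch sets of \<open>u\<close> and \<open>v\<close> would
  give walks from \<open>u\<close> to \<open>v\<close> and back, so acyclicity makes them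
  disjoint. On a walk from \<open>\<phi> u\<close> to
  \<open>\<phi> y\<^sub>u\<^sub>v\<close>, the arc entering the strongly connected component of
  \<open>\<phi> y\<^sub>u\<^sub>v\<close> joins the branch set of \<open>u\<close> to that of
  \<open>v\<close>.

  The branch sets may be infinite, but contracting the finitely many arcs that connect the ends
  of these joining arcs inside each branch set suffices.
\<close>

section \<open>Contracting connected branch sets\<close>

text \<open>
  The labellings \<open>c\<close> express that \<open>f\<close> identifies nothing beyond what
  \<open>F\<close> forces.
\<close>

lemma contract_arcs:
  fixes H :: "('b, 'c) pre_digraph"
  assumes "finite F" and "F \<subseteq> arcs H"
  shows "\<exists>f. reduces_to H \<lparr> verts = f ` verts H, arcs = arcs H - F,
             tail = f \<circ> tail H, head = f \<circ> head H \<rparr>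
           \<and> (\<forall>e\<in>F. f (tail H e) = f (head H e))
           \<and> (\<forall>c :: 'b \<Rightarrow> 'd. (\<forall>e\<in>F. c (tail H e) = c (head H e)) \<longrightarrow> c \<circ> f = c)"
  using assms
proof (induction F rule: finite_induct)
  case empty
  have "\<lparr> verts = id ` verts H, arcs = arcs H - {}, tail = id \<circ> tail H, head = id \<circ> head H \<rparr> = H"
    by simp
  then have "reduces_to H \<lparr> verts = id ` verts H, arcs = arcs H - {}, tail = id \<circ> tail H, head = id \<circ> head H \<rparr>"
    by (metis reduces_to.refl)
  then show ?case
    by (intro exI[of _ id] conjI) simp_all
next
  case (insert e F)
  then have "F \<subseteq> arcs H" by simp
  from insert.IH[OF this] obtain f where
    red: "reduces_to H \<lparr> verts = f ` verts H, arcs = arcs H - F,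
            tail = f \<circ> tail H, head = f \<circ> head H \<rparr>" (is "reduces_to H ?J")
    and id: "\<forall>e\<in>F. f (tail H e) = f (head H e)"
    and lab: "\<forall>c :: 'b \<Rightarrow> 'd. (\<forall>e\<in>F. c (tail H e) = c (head H e)) \<longrightarrow> c \<circ> f = c"
    by blast
  define g where "g = (\<lambda>v. if v = f (head H e) then f (tail H e) else v)"
  \<comment> \<open>As \<open>e\<close> is not in \<open>F\<close>, it is still an arc of
    \<open>?J\<close>. If its ends already coincide there, \<open>g\<close> is the identity and only
    a loop disappears.\<close>
  have "reduces_to H (contract_arc ?J e)"
    using red insert by (intro reduces_to.contract) auto
  also have "contract_arc ?J e = \<lparr> verts = (g \<circ> f) ` verts H, arcs = arcs H - insert e F,
            tail = (g \<circ> f) \<circ> tail H, head = (g \<circ> f) \<circ> head H \<rparr>"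
    by (auto simp: contract_arc_def Let_def g_def)
  finally have "reduces_to H \<lparr> verts = (g \<circ> f) ` verts H, arcs = arcs H - insert e F,
            tail = (g \<circ> f) \<circ> tail H, head = (g \<circ> f) \<circ> head H \<rparr>" .
  moreover have "\<forall>e'\<in>insert e F. (g \<circ> f) (tail H e') = (g \<circ> f) (head H e')"
    using id by (auto simp: g_def)
  moreover have "c \<circ> (g \<circ> f) = c"
    if c: "\<forall>e'\<in>insert e F. c (tail H e') = c (head H e')" for c :: "'b \<Rightarrow> 'd"
  proof
    fix v
    have cf: "c (f x) = c x" for x
      using lab c by (metis comp_apply insertCI)
    then show "(c \<circ> (g \<circ> f)) v = c v"
      using c by (auto simp: g_def) (metis cf)
  qed
  ultimately show ?case by blast
qed

text \<open>A walk uses only finitely many arcs, and their directions do not matter for equalities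
  between values of \<open>f\<close>. Quantifying over \<open>f\<close> lets the contraction map be
  inserted later.\<close>

lemma reachable_mk_symmetric_finite_arcs:
  fixes H :: "('b, 'c) pre_digraph"
  assumes "wf_digraph H" and "x \<rightarrow>\<^sup>*\<^bsub>mk_symmetric H\<^esub> y"
  shows "\<exists>F. finite F \<and> F \<subseteq> arcs H
    \<and> (\<forall>f :: 'b \<Rightarrow> 'd. (\<forall>e\<in>F. f (tail H e) = f (head H e)) \<longrightarrow> f x = f y)"
proof -
  interpret wf_digraph H by fact
  interpret S: pair_wf_digraph "mk_symmetric H" ..
  show ?thesis
    using assms(2)
  proof (induction rule: S.reachable_induct)
    case base
    then show ?case by (intro exI[of _ "{}"]) auto
  next
    case (step y z)
    then obtain F where F: "finite F" "F \<subseteq> arcs H"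
      "\<forall>f :: 'b \<Rightarrow> 'd. (\<forall>e\<in>F. f (tail H e) = f (head H e)) \<longrightarrow> f x = f y" by blast
    from step obtain e where "e \<in> arcs H"
      "y = tail H e \<and> z = head H e \<or> y = head H e \<and> z = tail H e"
      by (auto simp: parcs_mk_symmetric)
    moreover from this have "f x = f z"
      if "\<forall>e'\<in>insert e F. f (tail H e') = f (head H e')" for f :: "'b \<Rightarrow> 'd"
      using F(3) that by (metis insertCI)
    ultimately show ?case
      using F by (intro exI[of _ "insert e F"] conjI allI impI) simp_all
  qed
qed

text \<open>Each branch set contributes the vertex \<open>f (r u)\<close>. Contracting finite
  connections from \<open>r u\<close> to the ends of the chosen arcs \<open>\<epsilon> a\<close>
  makes these arcs join the right vertices; all else is deleted.\<close>

lemma has_minor_branch_setsI: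
  fixes G :: "'a pair_pre_digraph" and H :: "('b, 'c) pre_digraph"
  assumes "wf_digraph H" and "pair_digraph G"
    and sub: "\<And>u. u \<in> pverts G \<Longrightarrow> B u \<subseteq> verts H"
    and con: "\<And>u. u \<in> pverts G \<Longrightarrow> connected (H \<restriction> B u)"
    and disj: "disjoint_family_on B (pverts G)"
    and arc: "\<And>u v. (u, v) \<in> parcs G \<Longrightarrow> \<exists>e\<in>arcs H. tail H e \<in> B u \<and> head H e \<in> B v"
  shows "has_minor H (with_proj G)"
proof -
  interpret H: wf_digraph H by fact
  interpret G: pair_digraph G by fact
  have "\<forall>u\<in>pverts G. \<exists>x. x \<in> B u"
    using con by (force simp: connected_def strongly_connected_def)
  then obtain r where r: "\<And>u. u \<in> pverts G \<Longrightarrow> r u \<in> B u" by metis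
  have "\<forall>a\<in>parcs G. \<exists>e. e \<in> arcs H \<and> tail H e \<in> B (fst a) \<and> head H e \<in> B (snd a)"
    using arc by fastforce
  then obtain \<epsilon> where \<epsilon>: "\<And>a. a \<in> parcs G \<Longrightarrow>
      \<epsilon> a \<in> arcs H \<and> tail H (\<epsilon> a) \<in> B (fst a) \<and> head H (\<epsilon> a) \<in> B (snd a)" by metis
  have unique: "u = v" if "u \<in> pverts G" "v \<in> pverts G" "x \<in> B u" "x \<in> B v" for u v x
    using disj that by (auto simp: disjoint_family_on_def)

  have link: "\<exists>F. finite F \<and> F \<subseteq> arcs (H \<restriction> B u)
      \<and> (\<forall>f :: 'b \<Rightarrow> 'b. (\<forall>e\<in>F. f (tail H e) = f (head H e)) \<longrightarrow> f (r u) = f y)"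
    if "u \<in> pverts G" "y \<in> B u" for u y
  proof -
    have "wf_digraph (H \<restriction> B u)" ..
    moreover have "r u \<rightarrow>\<^sup>*\<^bsub>mk_symmetric (H \<restriction> B u)\<^esub> y"
      using con[OF that(1)] r that by (auto simp: connected_def strongly_connected_def)
    ultimately show ?thesis
      using reachable_mk_symmetric_finite_arcs[where 'd = 'b] by fastforce
  qed
  have "\<forall>a\<in>parcs G. \<exists>F. finite F \<and> F \<subseteq> arcs (H \<restriction> B (fst a))
      \<and> (\<forall>f :: 'b \<Rightarrow> 'b. (\<forall>e\<in>F. f (tail H e) = f (head H e)) \<longrightarrow> f (r (fst a)) = f (tail H (\<epsilon> a)))"
    using \<epsilon> G.arc_fst_in_verts by (intro ballI link) auto
  then obtain F1 where F1: "\<And>a. a \<in> parcs G \<Longrightarrow> finite (F1 a) \<and> F1 a \<subseteq> arcs (H \<restriction> B (fst a))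
      \<and> (\<forall>f :: 'b \<Rightarrow> 'b. (\<forall>e\<in>F1 a. f (tail H e) = f (head H e)) \<longrightarrow> f (r (fst a)) = f (tail H (\<epsilon> a)))"
    by metis
  have "\<forall>a\<in>parcs G. \<exists>F. finite F \<and> F \<subseteq> arcs (H \<restriction> B (snd a))
      \<and> (\<forall>f :: 'b \<Rightarrow> 'b. (\<forall>e\<in>F. f (tail H e) = f (head H e)) \<longrightarrow> f (r (snd a)) = f (head H (\<epsilon> a)))"
    using \<epsilon> G.arc_snd_in_verts by (intro ballI link) auto
  then obtain F2 where F2: "\<And>a. a \<in> parcs G \<Longrightarrow> finite (F2 a) \<and> F2 a \<subseteq> arcs (H \<restriction> B (snd a))
      \<and> (\<forall>f :: 'b \<Rightarrow> 'b. (\<forall>e\<in>F2 a. f (tail H e) = f (head H e)) \<longrightarrow> f (r (snd a)) = f (head H (\<epsilon> a)))"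
    by metis
  define F where "F = (\<Union>a\<in>parcs G. F1 a \<union> F2 a)"
  have "finite F"
    using F1 F2 G.pair_finite_arcs by (auto simp: F_def)
  have F_branch: "\<exists>u\<in>pverts G. e \<in> arcs (H \<restriction> B u)" if "e \<in> F" for e
    using that F1 F2 G.arc_fst_in_verts G.arc_snd_in_verts unfolding F_def by blast
  then have "F \<subseteq> arcs H" by fastforce
  \<comment> \<open>Disjointness makes this label at most a singleton. Arcs of \<open>F\<close> lie
    inside branch sets, so the label survives contraction: representatives stay distinct, and no
    \<open>\<epsilon> a\<close> belongs to \<open>F\<close>.\<close>
  define c where "c x = {u \<in> pverts G. x \<in> B u}" for x
  have c_eq: "c x = {u}" if "u \<in> pverts G" "x \<in> B u" for u x
    using that unique by (auto simp: c_def)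
  obtain f where
    red: "reduces_to H \<lparr> verts = f ` verts H, arcs = arcs H - F,
            tail = f \<circ> tail H, head = f \<circ> head H \<rparr>" (is "reduces_to H ?J")
    and id: "\<forall>e\<in>F. f (tail H e) = f (head H e)"
    and lab: "\<forall>c :: 'b \<Rightarrow> 'a set. (\<forall>e\<in>F. c (tail H e) = c (head H e)) \<longrightarrow> c \<circ> f = c"
    using contract_arcs[OF \<open>finite F\<close> \<open>F \<subseteq> arcs H\<close>] by blast
  have "\<forall>e\<in>F. c (tail H e) = c (head H e)"
  proof
    fix e assume "e \<in> F"
    then obtain u where "u \<in> pverts G" "tail H e \<in> B u" "head H e \<in> B u"
      using F_branch by fastforce
    then show "c (tail H e) = c (head H e)" by (simp add: c_eq)
  qed
  then have cf: "c (f x) = c x" for x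
    using lab by (metis comp_apply)

  have \<epsilon>_tail: "f (tail H (\<epsilon> a)) = f (r (fst a))" if "a \<in> parcs G" for a
    using F1[OF that] id that unfolding F_def by (metis UN_I UnI1)
  have \<epsilon>_head: "f (head H (\<epsilon> a)) = f (r (snd a))" if "a \<in> parcs G" for a
    using F2[OF that] id that unfolding F_def by (metis UN_I UnI2)
  have c_\<epsilon>: "c (tail H (\<epsilon> a)) = {fst a}" "c (head H (\<epsilon> a)) = {snd a}" if "a \<in> parcs G" for a
    using \<epsilon>[OF that] that by (auto intro!: c_eq G.arc_fst_in_verts G.arc_snd_in_verts)
  have "\<epsilon> a \<notin> F" if "a \<in> parcs G" for a
    using c_\<epsilon>[OF that] G.pair_no_loops[OF that] \<open>\<forall>e\<in>F. c (tail H e) = c (head H e)\<close> by auto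
  then have \<epsilon>_arcs: "\<epsilon> ` parcs G \<subseteq> arcs ?J"
    using \<epsilon> by auto
  have inj_r: "inj_on (f \<circ> r) (pverts G)"
    by (rule inj_onI) (metis cf c_eq comp_apply r singleton_inject)
  have inj_\<epsilon>: "inj_on \<epsilon> (parcs G)"
    by (rule inj_onI) (metis c_\<epsilon> prod_eqI singleton_inject)
  \<comment> \<open>The copy of \<open>G\<close> takes its end maps from \<open>?J\<close>, which
    gives compatibility as a subgraph; they agree with \<open>f \<circ> r\<close> by
    \<open>\<epsilon>_tail\<close> and \<open>\<epsilon>_head\<close>.\<close>
  define h where "h = \<lparr> iso_verts = f \<circ> r, iso_arcs = \<epsilon>,
    iso_head = f \<circ> head H, iso_tail = f \<circ> tail H \<rparr>"
  let ?K = "app_iso h (with_proj G)"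
  have iso: "pre_digraph.digraph_isomorphism (with_proj G) h"
    unfolding pre_digraph.digraph_isomorphism_def
    using inj_r inj_\<epsilon> \<epsilon>_tail \<epsilon>_head G.wf_digraph by (auto simp: h_def)
  have "wf_digraph ?J"
    by unfold_locales auto
  moreover have "wf_digraph ?K"
    by unfold_locales
      (auto simp: app_iso_def h_def \<epsilon>_tail \<epsilon>_head G.in_arcsD1 G.in_arcsD2)
  moreover have "(f \<circ> r) ` pverts G \<subseteq> verts ?J"
    using r sub by fastforce
  ultimately have "subgraph ?K ?J"
    using \<epsilon>_arcs by (auto simp: subgraph_def compatible_def app_iso_def h_def)
  then have "contains_digraph ?J (with_proj G)"
    unfolding contains_digraph_def digraph_iso_def using iso by blast
  with red show ?thesis
    unfolding has_minor_def by blast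
qed

section \<open>Reachability in the subdivision and in the host\<close>

text \<open>Arc costs are real, so a single walk keeps the infimum below \<open>\<infinity>\<close>;
  with no walk the infimum is over the empty set.\<close>

lemma (in wf_digraph) \<mu>_less_infinity_iff: "\<mu> f u v < \<infinity> \<longleftrightarrow> u \<rightarrow>\<^sup>* v"
proof
  assume "u \<rightarrow>\<^sup>* v"
  then obtain p where "awalk u p v" by (auto simp: reachable_awalk)
  from min_cost_le_walk_cost[OF this] show "\<mu> f u v < \<infinity>"
    by (metis PInfty_neq_ereal(1) ereal_infty_less(1) ereal_infty_less_eq(1))
next
  assume "\<mu> f u v < \<infinity>"
  then show "u \<rightarrow>\<^sup>* v"
    by (metis less_irrefl shortest_path_inf)
qed

text \<open>Multiplying by a positive real neither creates nor removes \<open>\<infinity>\<close>,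
  so the two bounds make both distances infinite together.\<close>

lemma bounded_distortion_reachable_iff:
  assumes "wf_digraph G" "wf_digraph H" "bounded_distortion G w H w' \<phi>"
    and "p \<in> verts G" "q \<in> verts G"
  shows "\<phi> p \<rightarrow>\<^sup>*\<^bsub>H\<^esub> \<phi> q \<longleftrightarrow> p \<rightarrow>\<^sup>*\<^bsub>G\<^esub> q"
proof -
  interpret G: wf_digraph G by fact
  interpret H: wf_digraph H by fact
  from assms obtain a b :: real where ab: "0 < a" "a \<le> b"
    and lower: "ereal a * G.\<mu> w p q \<le> H.\<mu> w' (\<phi> p) (\<phi> q)"
    and upper: "H.\<mu> w' (\<phi> p) (\<phi> q) \<le> ereal b * G.\<mu> w p q"
    unfolding bounded_distortion_def by blast
  have "H.\<mu> w' (\<phi> p) (\<phi> q) < \<infinity> \<longleftrightarrow> G.\<mu> w p q < \<infinity>"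
    using ab lower upper
    by (cases "G.\<mu> w p q"; cases "H.\<mu> w' (\<phi> p) (\<phi> q)") auto
  then show ?thesis
    unfolding G.\<mu>_less_infinity_iff H.\<mu>_less_infinity_iff .
qed

primrec edge_source :: "'a subdiv_vertex \<Rightarrow> 'a" where
  "edge_source (Orig u) = u"
| "edge_source (SubX u v) = u"
| "edge_source (SubY u v) = u"

primrec edge_target :: "'a subdiv_vertex \<Rightarrow> 'a" where
  "edge_target (Orig u) = u"
| "edge_target (SubX u v) = v"
| "edge_target (SubY u v) = v"

text \<open>A walk meeting original vertices meets \<open>Orig (edge_target p)\<close> first and
  \<open>Orig (edge_source q)\<close> last, and traverses edges of \<open>G\<close> in between. The
  other two cases cover walks inside one subdivided edge.\<close>

lemma reachable_subdivide3D:
  assumes "pair_wf_digraph G" and "p \<rightarrow>\<^sup>*\<^bsub>subdivide3 G\<^esub> q"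
  shows "p = q \<or> (\<exists>u v. p = SubX u v \<and> q = SubY u v)
    \<or> (edge_target p, edge_source q) \<in> (parcs G)\<^sup>*"
proof -
  interpret S: pair_wf_digraph "subdivide3 G"
    using assms(1) by (rule pair_wf_digraph_subdivide3)
  show ?thesis
    using assms(2)
  proof (induction rule: S.reachable_induct)
    case (step q r)
    then show ?case
      by (auto simp: subdivide3_def intro: rtrancl_into_rtrancl)
  qed simp
qed

section \<open>Walks inside induced subgraphs and across a boundary\<close>

text \<open>Connectedness ignores directions, so \<open>z\<close> can serve as a hub. For a branch
  set the hub is \<open>\<phi> (Orig u)\<close>.\<close>

lemma (in wf_digraph) connected_induceI:
  assumes "z \<in> S"
    and "\<And>x. x \<in> S \<Longrightarrow> x \<rightarrow>\<^sup>*\<^bsub>G \<restriction> S\<^esub> z \<or> z \<rightarrow>\<^sup>*\<^bsub>G \<restriction> S\<^esub> x"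
  shows "connected (G \<restriction> S)"
proof -
  interpret I: wf_digraph "G \<restriction> S" ..
  interpret M: pair_wf_digraph "mk_symmetric (G \<restriction> S)" ..
  have sym: "y \<rightarrow>\<^sup>*\<^bsub>mk_symmetric (G \<restriction> S)\<^esub> x" if "x \<rightarrow>\<^sup>*\<^bsub>mk_symmetric (G \<restriction> S)\<^esub> y" for x y
    using symmetric_mk_symmetric that by (rule symmetric_reachable)
  have to_z: "x \<rightarrow>\<^sup>*\<^bsub>mk_symmetric (G \<restriction> S)\<^esub> z" if "x \<in> S" for x
    using assms(2)[OF that] I.reachable_mk_symmetricI sym by blast
  show ?thesis
  proof (rule I.connectedI)
    show "verts (G \<restriction> S) \<noteq> {}"
      using assms(1) by auto
    fix x y assume "x \<in> verts (G \<restriction> S)" "y \<in> verts (G \<restriction> S)"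
    then show "x \<rightarrow>\<^sup>*\<^bsub>mk_symmetric (G \<restriction> S)\<^esub> y"
      by (intro M.reachable_trans[OF to_z sym[OF to_z]]) simp_all
  qed
qed

text \<open>Every vertex on a walk from \<open>x\<close> to \<open>y\<close> lies between them, so
  the whole walk stays in \<open>S\<close>.\<close>

lemma (in wf_digraph) reachable_induceI:
  assumes "x \<rightarrow>\<^sup>* y" and "\<And>g. x \<rightarrow>\<^sup>* g \<Longrightarrow> g \<rightarrow>\<^sup>* y \<Longrightarrow> g \<in> S"
  shows "x \<rightarrow>\<^sup>*\<^bsub>G \<restriction> S\<^esub> y"
  using assms
proof (induction rule: converse_reachable_induct)
  case base
  then have "y \<in> S" by blast
  then show ?case by (simp add: reachable_def)
next
  case (step x z)
  interpret I: wf_digraph "G \<restriction> S" ..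
  have "z \<rightarrow>\<^sup>*\<^bsub>G \<restriction> S\<^esub> y"
    using step adj_reachable_trans by blast
  moreover have "x \<in> S" "z \<in> S"
    using step.prems[of x] step.prems[of z] step.hyps adj_in_verts adj_reachable_trans by auto
  with \<open>x \<rightarrow> z\<close> have "x \<rightarrow>\<^bsub>G \<restriction> S\<^esub> z"
    by (auto simp: arcs_ends_conv)
  ultimately show ?case
    using I.adj_reachable_trans by blast
qed

text \<open>Take the first arc of the walk whose head satisfies \<open>P\<close>.\<close>

lemma (in wf_digraph) reachable_crossing_arc:
  assumes "x \<rightarrow>\<^sup>* y" and "\<not> P x" and "P y"
  shows "\<exists>e\<in>arcs G. x \<rightarrow>\<^sup>* tail G e \<and> \<not> P (tail G e) \<and> P (head G e) \<and> head G e \<rightarrow>\<^sup>* y"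
  using assms
proof (induction rule: converse_reachable_induct)
  case (step x z)
  then obtain e where e: "e \<in> arcs G" "x = tail G e" "z = head G e" by auto
  show ?case
  proof (cases "P z")
    case True
    with step e show ?thesis by (auto intro!: bexI[of _ e])
  next
    case False
    with step show ?thesis using adj_reachable_trans by blast
  qed
qed simp

section \<open>Branch sets of the images of original vertices\<close>

theorem theorem24:
  fixes G :: "'a pair_pre_digraph"
    and H :: "('b, 'c) pre_digraph"
    and w :: "'c \<Rightarrow> real"
    and \<phi> :: "'a subdiv_vertex \<Rightarrow> 'b"
  assumes "pair_fin_digraph G"
    and "acyclic (parcs G)"
    and "wf_digraph H"
    and "\<And>e. e \<in> arcs H \<Longrightarrow> 0 < w e"
    and "bounded_distortion (with_proj (subdivide3 G)) (\<lambda>_. 1) H w \<phi>"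
  shows "has_minor H (with_proj G)"
proof -
  interpret G: pair_fin_digraph G by fact
  interpret H: wf_digraph H by fact
  interpret S: pair_wf_digraph "subdivide3 G"
    using G.pair_wf_digraph_axioms by (rule pair_wf_digraph_subdivide3)
  have "fst e \<noteq> snd e" if "e \<in> parcs G" for e
    using assms(2) that by (metis acyclic_def prod.collapse r_into_trancl')
  then have "pair_digraph G" by unfold_locales
  have antisym: "u = v" if "(u, v) \<in> (parcs G)\<^sup>*" "(v, u) \<in> (parcs G)\<^sup>*" for u v
    using acyclic_impl_antisym_rtrancl[OF assms(2)] that by (auto dest: antisymD)
  have orig_in: "Orig u \<in> pverts (subdivide3 G)" if "u \<in> pverts G" for u
    using that by (auto simp: subdivide3_def)
  have sub_in: "SubY u v \<in> pverts (subdivide3 G)" if "(u, v) \<in> parcs G" for u v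
    using that by (auto simp: subdivide3_def)
  have \<phi>_in: "\<phi> p \<in> verts H" if "p \<in> pverts (subdivide3 G)" for p
    using assms(5) that by (auto simp: bounded_distortion_def)
  have iff: "\<phi> p \<rightarrow>\<^sup>*\<^bsub>H\<^esub> \<phi> q \<longleftrightarrow> p \<rightarrow>\<^sup>*\<^bsub>subdivide3 G\<^esub> q"
    if "p \<in> pverts (subdivide3 G)" "q \<in> pverts (subdivide3 G)" for p q
    using bounded_distortion_reachable_iff[OF S.wf_digraph assms(3,5)] that by simp
  have order: "p = q \<or> (\<exists>u v. p = SubX u v \<and> q = SubY u v)
      \<or> (edge_target p, edge_source q) \<in> (parcs G)\<^sup>*"
    if "p \<in> pverts (subdivide3 G)" "q \<in> pverts (subdivide3 G)"
      "\<phi> p \<rightarrow>\<^sup>*\<^bsub>H\<^esub> h" "h \<rightarrow>\<^sup>*\<^bsub>H\<^esub> \<phi> q" for p q h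
    using that iff H.reachable_trans G.pair_wf_digraph_axioms
    by (intro reachable_subdivide3D) blast+

  define In where "In u = {h. h \<rightarrow>\<^sup>*\<^bsub>H\<^esub> \<phi> (Orig u) \<and>
      (\<phi> (Orig u) \<rightarrow>\<^sup>*\<^bsub>H\<^esub> h \<or> (\<exists>t. (t, u) \<in> parcs G \<and> \<phi> (SubY t u) \<rightarrow>\<^sup>*\<^bsub>H\<^esub> h))}" for u
  \<comment> \<open>The negated clause leaves the strong component of
    \<open>\<phi> (SubY u v)\<close> to \<open>In v\<close>.\<close>
  define Out where "Out u = {h. \<phi> (Orig u) \<rightarrow>\<^sup>*\<^bsub>H\<^esub> h \<and>
      (\<exists>v. (u, v) \<in> parcs G \<and> h \<rightarrow>\<^sup>*\<^bsub>H\<^esub> \<phi> (SubY u v) \<and> \<not> \<phi> (SubY u v) \<rightarrow>\<^sup>*\<^bsub>H\<^esub> h)}" for u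
  define B where "B u = In u \<union> Out u" for u

  have \<phi>_B: "\<phi> (Orig u) \<in> B u" if "u \<in> pverts G" for u
    using \<phi>_in[OF orig_in[OF that]] by (auto simp: B_def In_def)
  have sub: "B u \<subseteq> verts H" for u
    by (auto simp: B_def In_def Out_def dest: H.reachable_in_verts)
  \<comment> \<open>Here \<open>p\<close> has edge target \<open>u\<close> and \<open>q\<close> has
    edge source \<open>v\<close>, so \<open>order\<close> gives the claim unless
    \<open>p = q = SubY u v'\<close>; the negated clause of \<open>Out\<close> excludes that.
    Exchanging \<open>u\<close> and \<open>v\<close> then yields disjointness by
    antisymmetry.\<close>
  have "(u, v) \<in> (parcs G)\<^sup>*"
    if uv: "u \<in> pverts G" "v \<in> pverts G" and h: "h \<in> B u" "h \<in> B v" for u v h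
  proof -
    from h(1) consider (orig) "\<phi> (Orig u) \<rightarrow>\<^sup>*\<^bsub>H\<^esub> h"
      | (sub) t where "(t, u) \<in> parcs G" "\<phi> (SubY t u) \<rightarrow>\<^sup>*\<^bsub>H\<^esub> h"
      by (auto simp: B_def In_def Out_def)
    then obtain p where p: "p \<in> pverts (subdivide3 G)" "\<phi> p \<rightarrow>\<^sup>*\<^bsub>H\<^esub> h"
      "p = Orig u \<or> (\<exists>t. p = SubY t u)"
      using orig_in[OF uv(1)] sub_in by cases blast+
    from h(2) consider (orig) "h \<rightarrow>\<^sup>*\<^bsub>H\<^esub> \<phi> (Orig v)"
      | (sub) v' where "(v, v') \<in> parcs G" "h \<rightarrow>\<^sup>*\<^bsub>H\<^esub> \<phi> (SubY v v')" "\<not> \<phi> (SubY v v') \<rightarrow>\<^sup>*\<^bsub>H\<^esub> h"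
      by (auto simp: B_def In_def Out_def)
    then obtain q where q: "q \<in> pverts (subdivide3 G)" "h \<rightarrow>\<^sup>*\<^bsub>H\<^esub> \<phi> q"
      "q = Orig v \<or> (\<exists>v'. q = SubY v v' \<and> \<not> \<phi> q \<rightarrow>\<^sup>*\<^bsub>H\<^esub> h)"
      using orig_in[OF uv(2)] sub_in by cases blast+
    from order[OF p(1) q(1) p(2) q(2)] show ?thesis
      using p(2,3) q(3) by auto
  qed
  then have disj: "disjoint_family_on B (pverts G)"
    using antisym unfolding disjoint_family_on_def by blast

  \<comment> \<open>\<open>In u\<close> contains all vertices between a member and the hub,
    \<open>Out u\<close> all those between the hub and a member, so the walks stay in
    \<open>B u\<close>.\<close>
  have con: "connected (H \<restriction> B u)" if "u \<in> pverts G" for u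
  proof (rule H.connected_induceI[OF \<phi>_B[OF that]])
    fix x assume "x \<in> B u"
    then consider "x \<in> In u" | "x \<in> Out u" by (auto simp: B_def)
    then show "x \<rightarrow>\<^sup>*\<^bsub>H \<restriction> B u\<^esub> \<phi> (Orig u) \<or> \<phi> (Orig u) \<rightarrow>\<^sup>*\<^bsub>H \<restriction> B u\<^esub> x"
    proof cases
      case 1
      then have "x \<rightarrow>\<^sup>*\<^bsub>H \<restriction> B u\<^esub> \<phi> (Orig u)"
        by (intro H.reachable_induceI) (auto simp: B_def In_def intro: H.reachable_trans)
      then show ?thesis ..
    next
      case 2
      then have "\<phi> (Orig u) \<rightarrow>\<^sup>*\<^bsub>H \<restriction> B u\<^esub> x"
        by (intro H.reachable_induceI) (auto simp: B_def Out_def intro: H.reachable_trans)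
      then show ?thesis ..
    qed
  qed

  have "\<exists>e\<in>arcs H. tail H e \<in> B u \<and> head H e \<in> B v" if uv: "(u, v) \<in> parcs G" for u v
  proof -
    have in_S: "Orig u \<in> pverts (subdivide3 G)" "Orig v \<in> pverts (subdivide3 G)"
      "SubY u v \<in> pverts (subdivide3 G)"
      using uv G.in_arcsD1 G.in_arcsD2 by (auto intro: orig_in sub_in)
    have "(Orig u, SubX u v) \<in> parcs (subdivide3 G)"
      "(SubX u v, SubY u v) \<in> parcs (subdivide3 G)" "(SubY u v, Orig v) \<in> parcs (subdivide3 G)"
      using uv by (auto simp: subdivide3_def)
    then have "Orig u \<rightarrow>\<^sup>*\<^bsub>subdivide3 G\<^esub> SubY u v" "SubY u v \<rightarrow>\<^sup>*\<^bsub>subdivide3 G\<^esub> Orig v"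
      by (auto intro: S.adj_reachable_trans)
    then have uy: "\<phi> (Orig u) \<rightarrow>\<^sup>*\<^bsub>H\<^esub> \<phi> (SubY u v)" and yv: "\<phi> (SubY u v) \<rightarrow>\<^sup>*\<^bsub>H\<^esub> \<phi> (Orig v)"
      using iff in_S by auto
    have "\<not> \<phi> (SubY u v) \<rightarrow>\<^sup>*\<^bsub>H\<^esub> \<phi> (Orig u)"
    proof
      assume "\<phi> (SubY u v) \<rightarrow>\<^sup>*\<^bsub>H\<^esub> \<phi> (Orig u)"
      then have "(v, u) \<in> (parcs G)\<^sup>*"
        using order[OF in_S(3,1)] \<phi>_in in_S by fastforce
      with uv assms(2) show False
        by (metis acyclic_def rtrancl_into_trancl2)
    qed
    \<comment> \<open>Crossing into the set reachable from \<open>\<phi> (SubY u v)\<close>: the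
      head of \<open>e\<close> lies in the strong component of that vertex, hence in
      \<open>In v\<close>; the tail reaches it but is not reached back, hence lies in
      \<open>Out u\<close>.\<close>
    with uy obtain e where "e \<in> arcs H" "\<phi> (Orig u) \<rightarrow>\<^sup>*\<^bsub>H\<^esub> tail H e"
      "\<not> \<phi> (SubY u v) \<rightarrow>\<^sup>*\<^bsub>H\<^esub> tail H e" "\<phi> (SubY u v) \<rightarrow>\<^sup>*\<^bsub>H\<^esub> head H e" "head H e \<rightarrow>\<^sup>*\<^bsub>H\<^esub> \<phi> (SubY u v)"
      using H.reachable_crossing_arc[OF uy, of "\<lambda>h. \<phi> (SubY u v) \<rightarrow>\<^sup>*\<^bsub>H\<^esub> h"] \<phi>_in in_S by blast
    moreover from this have "tail H e \<rightarrow>\<^sup>*\<^bsub>H\<^esub> \<phi> (SubY u v)"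
      using H.adj_reachable_trans H.in_arcs_imp_in_arcs_ends by blast
    ultimately show ?thesis
      using uv yv by (auto simp: B_def In_def Out_def intro!: bexI[of _ e] intro: H.reachable_trans)
  qed
  with assms(3) \<open>pair_digraph G\<close> sub con disj show ?thesis
    by (intro has_minor_branch_setsI)
qed

end
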